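(* Under the standing hypotheses described in the context, $D$ is an $\mathbb{F}_2$-linear set of $H_\infty$; that is, there is an $\mathbb{F}_2$-subspace $U$ of $\mathbb{F}_q^{2k}$ with $D=\{\langle u\rangle_{\mathbb{F}_q}: u\in U\setminus\{0\}\}$, where $H_\infty$ is identified with $\mathrm{PG}(\mathbb{F}_q^{2k})$.
   Context: Standing hypotheses: $q=2^h$ with $h\ge4$, $k\ge2$; $H_\infty\cong\mathrm{PG}(2k-1,q)$ is a hyperplane of $\mathrm{PG}(2k,q)$, points outside $H_\infty$ are affine; for distinct affine points $P,R$ the point $PR\cap H_\infty$ is the direction they determine. $\mathcal{Q}$ is a set of $q^k$ affine points, $D\subseteq H_\infty$ is the set of directions determined by pairs of distinct points of $\mathcal{Q}$, $|D|=q^k-1$, and every line of $\mathrm{PG}(2k,q)$ meets $D$ in $0$, $1$, $3$ or $q-1$ points. *)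

theory Defs
  imports "HOL-Analysis.Cartesian_Space"
begin

text \<open>
  The projective space of the vector space \<open>'a^'n\<close>: a subspace of projective dimension \<open>d\<close> is a
  vector subspace of dimension \<open>d + 1\<close>, and incidence is inclusion. Thus \<open>PG(2k,q)\<close> arises when
  \<open>CARD('a) = q\<close> and \<open>CARD('n) = 2k + 1\<close>.
\<close>

definition pg_points :: "('a::field ^ 'n::finite) set set" where
  "pg_points = {P. vec.subspace P \<and> vec.dim P = 1}"

definition pg_lines :: "('a::field ^ 'n::finite) set set" where
  "pg_lines = {l. vec.subspace l \<and> vec.dim l = 2}"

definition pg_hyperplanes :: "('a::field ^ 'n::finite) set set" where
  "pg_hyperplanes = {H. vec.subspace H \<and> vec.dim H + 1 = CARD('n)}"

definition affine_points :: "('a::field ^ 'n::finite) set \<Rightarrow> ('a ^ 'n) set set" where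
  "affine_points H = {P \<in> pg_points. \<not> P \<subseteq> H}"

definition join :: "('a::field ^ 'n::finite) set \<Rightarrow> ('a ^ 'n) set \<Rightarrow> ('a ^ 'n) set" where
  "join P R = vec.span (P \<union> R)"

definition directions :: "('a::field ^ 'n::finite) set \<Rightarrow> ('a ^ 'n) set set \<Rightarrow> ('a ^ 'n) set set" where
  "directions H Q = {join P R \<inter> H | P R. P \<in> Q \<and> R \<in> Q \<and> P \<noteq> R}"

text \<open>
  Subspaces over a subfield \<open>K\<close> of the ground field. In characteristic 2 the prime field
  \<open>F\<^sub>2\<close> is the subset \<open>{0, 1}\<close> of \<open>'a\<close>.
\<close>

definition subspace_over :: "'a::field set \<Rightarrow> ('a ^ 'n::finite) set \<Rightarrow> bool" where
  "subspace_over K U \<longleftrightarrow>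
     0 \<in> U \<and> (\<forall>u\<in>U. \<forall>v\<in>U. u + v \<in> U) \<and> (\<forall>c\<in>K. \<forall>u\<in>U. c *s u \<in> U)"

end

theory Submission
  imports Defs "HOL-Number_Theory.Residues"
begin

text \<open>
  Counting along the planes through a line with at least three points of the set \<open>A\<close> of affine
  points shows that there is no such line. Hence every point of \<open>A\<close> sees each direction exactly
  once, and every plane on a line at infinity with \<open>j\<close> directions contains \<open>0\<close> or \<open>j + 1\<close> points
  of \<open>A\<close>. It follows that no two lines with \<open>q - 1\<close> directions meet in a direction. In a plane on a
  line with three directions, the four points of \<open>A\<close> form a parallelogram (Fano configuration).
  The same holds for \<open>P, P + a, P + b\<close> in a plane on a line with \<open>q - 1\<close> directions: choose
  \<open>P + c \<in> A\<close> outside that plane and complete first \<open>P, P + a, P + c\<close>, then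
  \<open>P + c, P + c + a, P + b\<close>. So \<open>A\<close> is a translate of an additive group.
\<close>

section \<open>Cardinality and dimension of subspaces over a finite field\<close>

lemma mem_span_scale_imp:
  fixes S :: "('a::field ^ 'm::finite) set"
  assumes "c *s a \<in> vec.span S" "a \<notin> vec.span S"
  shows "c = 0"
proof (rule ccontr)
  assume "c \<noteq> 0"
  then have "(1 / c) *s (c *s a) = a" by simp
  then show False using vec.span_scale[OF assms(1), of "1 / c"] assms(2) by simp
qed

text \<open>The pair \<open>(c, x)\<close> in \<open>c *s a + x\<close> is unique, since
  \<open>a\<close> lies outside \<open>vec.span S\<close>. Iterating along a basis gives the
  cardinality of every subspace, so that dimensions can be read off from cardinalities.\<close>

lemma card_span_insert:
  fixes S :: "('a::{field,finite} ^ 'm::finite) set"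
  assumes "a \<notin> vec.span S"
  shows "card (vec.span (insert a S)) = CARD('a) * card (vec.span S)"
proof -
  have "inj_on (\<lambda>(c, x). c *s a + x) (UNIV \<times> vec.span S)"
  proof (rule inj_onI, clarsimp)
    fix c x d y assume x: "x \<in> vec.span S" and y: "y \<in> vec.span S"
      and eq: "c *s a + x = d *s a + y"
    have "(c - d) *s a = y - x"
      using eq by (simp add: vec.scale_left_diff_distrib algebra_simps)
    then have "(c - d) *s a \<in> vec.span S"
      using x y by (simp add: vec.span_diff)
    then have "c = d"
      using assms mem_span_scale_imp[of "c - d"] by simp
    then show "c = d \<and> x = y" using eq by simp
  qed
  moreover have "(\<lambda>(c, x). c *s a + x) ` (UNIV \<times> vec.span S) = vec.span (insert a S)"
  proof (intro equalityI subsetI)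
    fix v assume "v \<in> (\<lambda>(c, x). c *s a + x) ` (UNIV \<times> vec.span S)"
    then obtain c x where "v = c *s a + x" "x \<in> vec.span S" by auto
    then have "v - c *s a \<in> vec.span S" by simp
    then show "v \<in> vec.span (insert a S)" by (auto simp: vec.span_breakdown_eq)
  next
    fix v assume "v \<in> vec.span (insert a S)"
    then obtain c where "v - c *s a \<in> vec.span S" by (auto simp: vec.span_breakdown_eq)
    then show "v \<in> (\<lambda>(c, x). c *s a + x) ` (UNIV \<times> vec.span S)"
      by (intro image_eqI[of _ _ "(c, v - c *s a)"]) auto
  qed
  ultimately show ?thesis
    by (metis card_cartesian_product card_image)
qed

lemma card_subspace:
  fixes S :: "('a::{field,finite} ^ 'm::finite) set"
  assumes "vec.subspace S"
  shows "card S = CARD('a) ^ vec.dim S"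
proof -
  obtain B where B: "B \<subseteq> S" "vec.independent B" "S \<subseteq> vec.span B" "card B = vec.dim S"
    using vec.basis_exists by blast
  have "finite B" by simp
  then have "vec.independent B \<Longrightarrow> card (vec.span B) = CARD('a) ^ card B"
    by (induction B rule: finite_induct) (auto simp: card_span_insert vec.independent_insert)
  then show ?thesis
    using B assms vec.span_minimal[of B S] by auto
qed

lemma card_field_gt_1: "CARD('a::{field,finite}) > 1"
  using card_mono[of "UNIV :: 'a set" "{0, 1}"] by simp

lemma dim_eqI:
  fixes S :: "('a::{field,finite} ^ 'm::finite) set"
  assumes "vec.subspace S" "card S = CARD('a) ^ n"
  shows "vec.dim S = n"
  using card_subspace[OF assms(1)] assms(2) card_field_gt_1[where 'a='a] power_inject_exp by metis

lemma subspace_eqI: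
  fixes S T :: "('a::{field,finite} ^ 'm::finite) set"
  assumes "vec.subspace S" "vec.subspace T" "S \<subseteq> T" "vec.dim S = vec.dim T"
  shows "S = T"
  using assms by (intro card_subset_eq) (auto simp: card_subspace)

lemma card_span_single:
  fixes v :: "'a::{field,finite} ^ 'm::finite"
  assumes "v \<noteq> 0"
  shows "card (vec.span {v}) = CARD('a)"
  using card_span_insert[of v "{}"] assms by simp

lemma dim_span_single:
  fixes v :: "'a::{field,finite} ^ 'm::finite"
  assumes "v \<noteq> 0"
  shows "vec.dim (vec.span {v}) = 1"
  by (rule dim_eqI) (use assms in \<open>simp_all add: card_span_single\<close>)

lemma dim_span_pair:
  fixes v :: "'a::{field,finite} ^ 'm::finite"
  assumes "v \<noteq> 0" "w \<notin> vec.span {v}"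
  shows "vec.dim (vec.span {v, w}) = 2"
proof (rule dim_eqI)
  show "card (vec.span {v, w}) = CARD('a) ^ 2"
    using card_span_insert[of w "{v}"] assms
    by (simp add: card_span_single insert_commute power2_eq_square)
qed simp

lemma span_pair_eq:
  fixes v :: "'a::{field,finite} ^ 'm::finite"
  assumes "vec.subspace L" "vec.dim L = 2" "v \<noteq> 0" "w \<notin> vec.span {v}" "v \<in> L" "w \<in> L"
  shows "vec.span {v, w} = L"
proof (rule subspace_eqI)
  show "vec.span {v, w} \<subseteq> L" using assms by (intro vec.span_minimal) auto
qed (use assms dim_span_pair[of v w] in simp_all)

lemma span_single_eq:
  fixes v :: "'a::{field,finite} ^ 'm::finite"
  assumes "w \<in> vec.span {v}" "w \<noteq> 0"
  shows "vec.span {w} = vec.span {v}"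
proof (rule subspace_eqI)
  have "v \<noteq> 0" using assms by auto
  then show "vec.dim (vec.span {w}) = vec.dim (vec.span {v})"
    using assms(2) by (simp only: dim_span_single[OF assms(2)] dim_span_single[of v] not_False_eq_True)
  show "vec.span {w} \<subseteq> vec.span {v}" using assms by (intro vec.span_minimal) auto
qed simp_all

lemma span_single_subset_iff:
  fixes v :: "'a::field ^ 'm::finite"
  assumes "vec.subspace L"
  shows "vec.span {v} \<subseteq> L \<longleftrightarrow> v \<in> L"
  using assms vec.span_minimal[of "{v}" L] vec.span_base[of v "{v}"] by auto

section \<open>Double counting over cosets and pencils\<close>

text \<open>Double counting of the pairs \<open>(x, w)\<close> with \<open>x - w\<close> in
  \<open>L\<close>: each \<open>x\<close> has \<open>card L\<close> partners \<open>w\<close>.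
  Summing over all \<open>w\<close> instead of coset representatives counts every coset
  \<open>card L\<close> times and avoids a choice.\<close>

lemma card_le_cosets:
  fixes W :: "('a::{field,finite} ^ 'm::finite) set"
  assumes W: "vec.subspace W" and L: "vec.subspace L" "L \<subseteq> W" and X: "X \<subseteq> W"
    and c: "\<And>w. w \<in> W \<Longrightarrow> card {x \<in> X. x - w \<in> L} \<le> c"
  shows "card X * card L \<le> c * card W"
proof -
  have "card X * card L = (\<Sum>x\<in>X. card {w \<in> W. x - w \<in> L})"
  proof -
    have "card {w \<in> W. x - w \<in> L} = card L" if "x \<in> X" for x
    proof -
      have "{w \<in> W. x - w \<in> L} = (\<lambda>l. x - l) ` L"
      proof (intro equalityI subsetI)
        fix w assume "w \<in> {w \<in> W. x - w \<in> L}"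
        then show "w \<in> (\<lambda>l. x - l) ` L" by (intro image_eqI[of _ _ "x - w"]) auto
      next
        fix w assume "w \<in> (\<lambda>l. x - l) ` L"
        then show "w \<in> {w \<in> W. x - w \<in> L}"
          using that X L W by (auto intro: vec.subspace_diff)
      qed
      then show ?thesis by (simp add: card_image inj_on_def)
    qed
    then show ?thesis by simp
  qed
  also have "\<dots> = (\<Sum>w\<in>W. card {x \<in> X. x - w \<in> L})"
    by (rule sum_multicount_gen) auto
  also have "\<dots> \<le> c * card W"
    using sum_mono[of W "\<lambda>w. card {x \<in> X. x - w \<in> L}" "\<lambda>_. c"] c by (simp add: mult.commute)
  finally show ?thesis .
qed

text \<open>\<open>CARD('a) + 1\<close> is the number of planes of \<open>W\<close> through \<open>u\<close>.\<close>

lemma card_pencil: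
  fixes W :: "('a::{field,finite} ^ 'm::finite) set"
  assumes W: "vec.subspace W" "vec.dim W = 3" and u: "u \<in> W" "u \<noteq> 0" and Y: "Y \<subseteq> W"
    and c: "\<And>L. vec.subspace L \<Longrightarrow> vec.dim L = 2 \<Longrightarrow> u \<in> L \<Longrightarrow> L \<subseteq> W \<Longrightarrow>
             card (Y \<inter> L - vec.span {u}) = c"
  shows "card (Y - vec.span {u}) = (CARD('a) + 1) * c"
proof -
  let ?q = "CARD('a)" and ?e = "vec.span {u}"
  define \<L> where "\<L> = {L. vec.subspace L \<and> vec.dim L = 2 \<and> u \<in> L \<and> L \<subseteq> W}"
  \<comment> \<open>Kept general in \<open>Z\<close>: with \<open>Z = W\<close> it yields the number
    of planes, with \<open>Z = Y\<close> the claim. Every vector of \<open>Z\<close> off the axis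
    spans a unique plane together with \<open>u\<close>.\<close>
  have count: "card (Z - ?e) = c' * card \<L>"
    if Z: "Z \<subseteq> W" and c': "\<And>L. L \<in> \<L> \<Longrightarrow> card (Z \<inter> L - ?e) = c'" for Z c'
  proof -
    have "Z - ?e \<subseteq> (\<Union>L\<in>\<L>. Z \<inter> L - ?e)"
    proof
      fix y assume y: "y \<in> Z - ?e"
      then have "vec.span {u, y} \<subseteq> W" using u Z W by (intro vec.span_minimal) auto
      then have "vec.span {u, y} \<in> \<L>"
        using u y dim_span_pair[of u y] by (simp add: \<L>_def vec.span_base)
      then show "y \<in> (\<Union>L\<in>\<L>. Z \<inter> L - ?e)"
        using y by (auto intro!: bexI[of _ "vec.span {u, y}"] simp: vec.span_base)
    qed
    then have eq: "Z - ?e = (\<Union>L\<in>\<L>. Z \<inter> L - ?e)" by auto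
    have "card (\<Union>L\<in>\<L>. Z \<inter> L - ?e) = (\<Sum>L\<in>\<L>. card (Z \<inter> L - ?e))"
    proof (rule card_UN_disjoint)
      show "\<forall>L\<in>\<L>. \<forall>L'\<in>\<L>. L \<noteq> L' \<longrightarrow> (Z \<inter> L - ?e) \<inter> (Z \<inter> L' - ?e) = {}"
      proof (intro ballI impI, rule ccontr)
        fix L L' assume L: "L \<in> \<L>" "L' \<in> \<L>" "L \<noteq> L'"
          and "(Z \<inter> L - ?e) \<inter> (Z \<inter> L' - ?e) \<noteq> {}"
        then obtain y where "y \<in> L" "y \<in> L'" "y \<notin> ?e" by auto
        then show False
          using L u span_pair_eq[of L u y] span_pair_eq[of L' u y] by (auto simp: \<L>_def)
      qed
    qed auto
    then show ?thesis using c' eq by simp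
  qed
  have q: "?q > 1" by (rule card_field_gt_1)
  have "card (W - ?e) = (?q * ?q - ?q) * card \<L>"
  proof (rule count)
    fix L assume L: "L \<in> \<L>"
    then have "W \<inter> L - ?e = L - ?e" "?e \<subseteq> L"
      by (auto simp: \<L>_def span_single_subset_iff)
    moreover have "card L = ?q * ?q"
      using L card_subspace[of L] by (simp add: \<L>_def power2_eq_square)
    ultimately show "card (W \<inter> L - ?e) = ?q * ?q - ?q"
      using u by (simp add: card_Diff_subset card_span_single)
  qed simp
  moreover have "card (W - ?e) = ?q ^ 3 - ?q"
    using W u card_subspace[of W] span_single_subset_iff[of W u]
    by (simp add: card_Diff_subset card_span_single)
  moreover have "?q ^ 3 - ?q = (?q * ?q - ?q) * (?q + 1)"
    by (simp add: algebra_simps power3_eq_cube)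
  ultimately have "(?q * ?q - ?q) * (?q + 1) = (?q * ?q - ?q) * card \<L>" by simp
  moreover have "?q * ?q - ?q > 0" using q by simp
  ultimately have "card \<L> = ?q + 1"
    by (metis mult_left_cancel less_numeral_extra(3))
  then show ?thesis
    using count[OF Y, of c] c by (simp add: \<L>_def mult.commute)
qed

section \<open>Affine point sets with few directions\<close>

text \<open>The affine form of the problem, with q short for \<open>CARD('a)\<close>: affine points
  are vectors, the direction of \<open>P\<close> and \<open>R\<close> is the span of
  \<open>R - P\<close>, and a line at infinity is a two-dimensional \<open>L\<close>, whose cosets
  are the affine planes through it.\<close>

locale few_directions =
  fixes A :: "('a::{field,finite} ^ 'm::finite) set"
    and D :: "('a ^ 'm) set set"
    and k :: nat
  assumes D_def: "D = {vec.span {R - P} | P R. P \<in> A \<and> R \<in> A \<and> P \<noteq> R}"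
    and card_A: "card A = CARD('a) ^ k"
    and card_D: "card D = CARD('a) ^ k - 1"
    and k: "k \<ge> 2"
    and q: "CARD('a) \<ge> 16"
    and secants: "\<And>L. vec.subspace L \<Longrightarrow> vec.dim L = 2 \<Longrightarrow>
           card {d \<in> D. d \<subseteq> L} \<in> {0, 1, 3, CARD('a) - 1}"
begin

text \<open>The points of \<open>A\<close> in the coset of \<open>L\<close> through
  \<open>P\<close>: a section by an affine line or plane when \<open>L\<close> has dimension 1 or 2.
  The point \<open>P\<close> itself may lie outside \<open>A\<close>.\<close>

definition sect :: "'a ^ 'm \<Rightarrow> ('a ^ 'm) set \<Rightarrow> ('a ^ 'm) set" where
  "sect P L = {R \<in> A. R - P \<in> L}"

definition dirs :: "('a ^ 'm) set \<Rightarrow> ('a ^ 'm) set set" where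
  "dirs L = {d \<in> D. d \<subseteq> L}"

lemma card_dirs:
  "vec.subspace L \<Longrightarrow> vec.dim L = 2 \<Longrightarrow> card (dirs L) \<in> {0, 1, 3, CARD('a) - 1}"
  unfolding dirs_def by (rule secants)

lemma D_I: "P \<in> A \<Longrightarrow> R \<in> A \<Longrightarrow> P \<noteq> R \<Longrightarrow> vec.span {R - P} \<in> D"
  by (auto simp: D_def)

lemma D_E:
  assumes "d \<in> D"
  obtains v where "v \<noteq> 0" "d = vec.span {v}"
proof -
  obtain P R where "P \<noteq> R" "d = vec.span {R - P}" using assms by (auto simp: D_def)
  then show thesis using that[of "R - P"] by simp
qed

lemma dirs_I:
  "P \<in> A \<Longrightarrow> R \<in> A \<Longrightarrow> P \<noteq> R \<Longrightarrow> R - P \<in> L \<Longrightarrow> vec.subspace L \<Longrightarrow> vec.span {R - P} \<in> dirs L"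
  by (auto simp: dirs_def span_single_subset_iff dest: D_I)

lemma q_less_card_A: "CARD('a) < card A"
  using card_A k q power_strict_increasing[of 1 k "CARD('a)"] by simp

text \<open>The q - 1 directions cover at most (q - 1)^2 of the q^2 - 1 nonzero vectors of
  \<open>L\<close>.\<close>

lemma non_direction_exists:
  assumes L: "vec.subspace L" "vec.dim L = 2" and c: "card (dirs L) = CARD('a) - 1"
  obtains z where "z \<in> L" "z \<noteq> 0" "vec.span {z} \<notin> D"
proof (rule ccontr)
  let ?q = "CARD('a)"
  assume "\<not> thesis"
  then have *: "z \<in> L \<Longrightarrow> z \<noteq> 0 \<Longrightarrow> vec.span {z} \<in> D" for z using that by blast
  have "L - {0} \<subseteq> (\<Union>d\<in>dirs L. d - {0})"
  proof
    fix z assume z: "z \<in> L - {0}"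
    then have "vec.span {z} \<in> dirs L"
      using * L by (auto simp: dirs_def span_single_subset_iff)
    then show "z \<in> (\<Union>d\<in>dirs L. d - {0})"
      using z vec.span_base[of z "{z}"] by blast
  qed
  then have "card (L - {0}) \<le> card (\<Union>d\<in>dirs L. d - {0})" by (intro card_mono) auto
  also have "\<dots> \<le> (\<Sum>d\<in>dirs L. card (d - {0}))" by (intro card_UN_le) auto
  also have "\<dots> = (\<Sum>d\<in>dirs L. ?q - 1)"
  proof (rule sum.cong)
    fix d assume "d \<in> dirs L"
    then obtain v where "v \<noteq> 0" "d = vec.span {v}" by (auto simp: dirs_def elim: D_E)
    then show "card (d - {0}) = ?q - 1"
      by (simp add: card_Diff_singleton vec.span_zero card_span_single)
  qed simp
  also have "\<dots> = (?q - 1) * (?q - 1)" using c by simp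
  finally have "?q * ?q - 1 \<le> (?q - 1) * (?q - 1)"
    using L card_subspace[of L] vec.subspace_0[of L]
    by (simp add: card_Diff_singleton power2_eq_square)
  moreover have "(?q - 1) * (?q - 1) < ?q * (?q - 1)" using q by (intro mult_strict_right_mono) auto
  moreover have "?q * (?q - 1) \<le> ?q * ?q - 1" using q by (simp add: algebra_simps)
  ultimately show False by linarith
qed

text \<open>The q lines of this plane parallel to a non-direction \<open>z\<close> hold at most one
  point of \<open>A\<close> each, as two points on such a line would determine
  \<open>z\<close>.\<close>

lemma card_sect_le:
  assumes L: "vec.subspace L" "vec.dim L = 2" and c: "card (dirs L) = CARD('a) - 1"
  shows "card (sect P L) \<le> CARD('a)"
proof -
  let ?q = "CARD('a)"
  obtain z where z: "z \<in> L" "z \<noteq> 0" "vec.span {z} \<notin> D"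
    using non_direction_exists[OF assms] .
  define X where "X = (\<lambda>R. R - P) ` sect P L"
  have "card X * card (vec.span {z}) \<le> 1 * card L"
  proof (rule card_le_cosets)
    show "X \<subseteq> L" by (auto simp: X_def sect_def)
    fix w assume "w \<in> L"
    show "card {x \<in> X. x - w \<in> vec.span {z}} \<le> 1"
    proof (rule card_le_Suc0_iff_eq[THEN iffD2, unfolded One_nat_def[symmetric]], simp,
        intro ballI)
      fix x y assume "x \<in> {x \<in> X. x - w \<in> vec.span {z}}" "y \<in> {x \<in> X. x - w \<in> vec.span {z}}"
      then obtain R S where RS: "R \<in> A" "S \<in> A" "x = R - P" "y = S - P"
        and "x - w \<in> vec.span {z}" "y - w \<in> vec.span {z}"
        unfolding X_def sect_def by blast
      then have "(x - w) - (y - w) \<in> vec.span {z}" by (intro vec.span_diff[of "x - w"])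
      then have RS': "R - S \<in> vec.span {z}" using RS by simp
      show "x = y"
      proof (rule ccontr)
        assume "x \<noteq> y"
        then have "R \<noteq> S" using RS by auto
        then show False
          using RS' RS z(3) span_single_eq[of "R - S" z] D_I[of S R] by auto
      qed
    qed
  qed (use L z in \<open>auto simp: span_single_subset_iff\<close>)
  then have "card X * ?q \<le> ?q * ?q"
    using L z card_subspace[of L] by (simp add: card_span_single power2_eq_square)
  then have "card X \<le> ?q" using q by simp
  then show ?thesis by (simp add: X_def card_image inj_on_def)
qed

section \<open>No three collinear points\<close>

text \<open>Let a line hold t \<ge> 3 points of \<open>A\<close>. Every plane through it with a
  further point of \<open>A\<close> has q - 1 directions, hence at most q - t points off the line
  and exactly q - 2 directions besides that of the line. Counting points and directions over these n
  planes bounds n from both sides, and the bounds combine to (t - 2)(|A| - q) \<le> 0.\<close>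

lemma card_sect_line:
  assumes P: "P \<in> A" and v: "v \<noteq> 0"
  shows "card (sect P (vec.span {v})) \<le> 2"
proof (rule ccontr)
  let ?q = "CARD('a)" and ?e = "vec.span {v}"
  define T where "T = sect P ?e"
  assume "\<not> card (sect P ?e) \<le> 2"
  then have t: "card T \<ge> 3" by (simp add: T_def)
  have T_A: "T \<subseteq> A" by (auto simp: T_def sect_def)
  have P_T: "P \<in> T" using P by (simp add: T_def sect_def vec.span_zero)
  have "card ((\<lambda>R. R - P) ` T) \<le> card ?e" by (intro card_mono) (auto simp: T_def sect_def)
  then have tq: "card T \<le> ?q" using v by (simp add: card_image inj_on_def card_span_single)
  have "\<not> card T \<le> card {P}" using t by simp
  then obtain P' where P': "P' \<in> T" "P' \<noteq> P" using card_mono[of "{P}" T] by blast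
  have e_D: "?e \<in> D"
    using P' P T_A span_single_eq[of "P' - P" v] D_I[of P P'] by (auto simp: T_def sect_def)
  define \<L> where "\<L> = (\<lambda>R. vec.span {v, R - P}) ` (A - T)"
  have \<L>: "vec.subspace L" "vec.dim L = 2" "v \<in> L" "?e \<subseteq> L" "card (dirs L) = ?q - 1"
    if L: "L \<in> \<L>" for L
  proof -
    obtain R where R: "R \<in> A" "R - P \<notin> ?e" "L = vec.span {v, R - P}"
      using L by (auto simp: \<L>_def T_def sect_def)
    show sub: "vec.subspace L" and dim: "vec.dim L = 2" and vL: "v \<in> L"
      using R v dim_span_pair[of v "R - P"] by (auto simp: vec.span_base)
    then show eL: "?e \<subseteq> L" by (simp add: span_single_subset_iff)
    have S: "S \<in> A" "S \<noteq> R" "R - S \<in> L" "R - S \<notin> ?e" if "S \<in> T" for S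
    proof -
      have s: "S \<in> A" "S - P \<in> ?e" using that by (auto simp: T_def sect_def)
      show "S \<in> A" by fact
      show "R - S \<notin> ?e"
      proof
        assume "R - S \<in> ?e"
        then have "(R - S) + (S - P) \<in> ?e" using s by (intro vec.span_add)
        then show False using R by simp
      qed
      then show "S \<noteq> R" by (auto simp: vec.span_zero)
      have "(R - P) - (S - P) \<in> L"
      proof (rule vec.subspace_diff[OF sub])
        show "R - P \<in> L" using R by (simp add: vec.span_base)
        show "S - P \<in> L" using s eL by blast
      qed
      then show "R - S \<in> L" by simp
    qed
    have inj: "inj_on (\<lambda>S. vec.span {R - S}) T"
    proof (rule inj_onI, rule ccontr)
      fix S S' assume h: "S \<in> T" "S' \<in> T" "vec.span {R - S} = vec.span {R - S'}" "S \<noteq> S'"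
      have "R - S' \<in> vec.span {R - S}" using h vec.span_base[of "R - S'"] by simp
      then have "(R - S) - (R - S') \<in> vec.span {R - S}"
        by (intro vec.span_diff[of "R - S"]) (auto simp: vec.span_base)
      moreover have "(R - S) - (R - S') = S' - S" by simp
      ultimately have a: "vec.span {S' - S} = vec.span {R - S}"
        using h span_single_eq[of "S' - S" "R - S"] by simp
      have "(S' - P) - (S - P) \<in> ?e"
        using h by (intro vec.span_diff[of "S' - P"]) (auto simp: T_def sect_def)
      then have "vec.span {S' - S} = ?e" using h span_single_eq[of "S' - S" v] by simp
      then show False using a S[OF h(1)] vec.span_base[of "R - S"] by auto
    qed
    \<comment> \<open>The direction of the line and those from \<open>R\<close> to the points of
      \<open>T\<close> are at least four different ones, which leaves only the value q - 1.\<close>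
    have "insert ?e ((\<lambda>S. vec.span {R - S}) ` T) \<subseteq> dirs L"
      using dirs_I[OF S(1) R(1) S(2,3) sub] e_D eL by (auto simp: dirs_def)
    then have "card (insert ?e ((\<lambda>S. vec.span {R - S}) ` T)) \<le> card (dirs L)"
      by (intro card_mono) auto
    moreover have "?e \<notin> (\<lambda>S. vec.span {R - S}) ` T"
      using S vec.span_base by blast
    ultimately have "card T + 1 \<le> card (dirs L)" using inj by (simp add: card_image)
    then show "card (dirs L) = ?q - 1" using t card_dirs[OF sub dim] by auto
  qed
  have "card (A - T) \<le> card (\<Union>L\<in>\<L>. sect P L - T)"
  proof (rule card_mono)
    show "A - T \<subseteq> (\<Union>L\<in>\<L>. sect P L - T)"
      by (auto simp: \<L>_def sect_def vec.span_base)
  qed simp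
  also have "\<dots> \<le> (\<Sum>L\<in>\<L>. card (sect P L - T))" by (intro card_UN_le) auto
  also have "\<dots> \<le> (\<Sum>L\<in>\<L>. ?q - card T)"
  proof (rule sum_mono)
    fix L assume L: "L \<in> \<L>"
    have "T \<subseteq> sect P L" using \<L>(4)[OF L] by (auto simp: T_def sect_def)
    then show "card (sect P L - T) \<le> ?q - card T"
      using card_sect_le[of L P] \<L>[OF L] by (simp add: card_Diff_subset diff_le_mono)
  qed
  finally have 1: "card A - card T \<le> card \<L> * (?q - card T)"
    using T_A by (simp add: card_Diff_subset)
  \<comment> \<open>Two of the planes share no direction besides \<open>?e\<close>, so the other
    directions are counted without overlap; their number is at most \<open>card D - 1\<close>, which
    is \<open>card A - 2\<close>.\<close>
  have "(\<Sum>L\<in>\<L>. ?q - 2) = (\<Sum>L\<in>\<L>. card (dirs L - {?e}))"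
  proof (rule sum.cong)
    fix L assume L: "L \<in> \<L>"
    have "?e \<in> dirs L" using e_D \<L>[OF L] by (simp add: dirs_def)
    then show "?q - 2 = card (dirs L - {?e})" using \<L>[OF L] by (simp add: card_Diff_singleton)
  qed simp
  also have "\<dots> = card (\<Union>L\<in>\<L>. dirs L - {?e})"
  proof (rule card_UN_disjoint[symmetric])
    show "\<forall>L\<in>\<L>. \<forall>L'\<in>\<L>. L \<noteq> L' \<longrightarrow> (dirs L - {?e}) \<inter> (dirs L' - {?e}) = {}"
    proof (intro ballI impI, rule ccontr)
      fix L L' assume L: "L \<in> \<L>" "L' \<in> \<L>" "L \<noteq> L'"
        and "(dirs L - {?e}) \<inter> (dirs L' - {?e}) \<noteq> {}"
      then obtain d where d: "d \<in> D" "d \<subseteq> L" "d \<subseteq> L'" "d \<noteq> ?e" by (auto simp: dirs_def)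
      obtain w where w: "w \<noteq> 0" "d = vec.span {w}" using d(1) by (rule D_E)
      have "w \<in> d" using w vec.span_base[of w "{w}"] by simp
      moreover have "w \<notin> ?e" using w d span_single_eq[of w v] by auto
      ultimately have "vec.span {v, w} = L" "vec.span {v, w} = L'"
        using span_pair_eq[OF \<L>(1,2)[OF L(1)] v _ \<L>(3)[OF L(1)], of w]
          span_pair_eq[OF \<L>(1,2)[OF L(2)] v _ \<L>(3)[OF L(2)], of w] d by blast+
      then show False using L by simp
    qed
  qed auto
  also have "\<dots> \<le> card (D - {?e})" by (intro card_mono) (auto simp: dirs_def)
  finally have 2: "card \<L> * (?q - 2) \<le> card A - 2"
    using e_D card_D card_A by (simp add: card_Diff_singleton)
  \<comment> \<open>Integers avoid truncated subtraction in the elimination below.\<close>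
  define a n t q' where "a = int (card A)" and "n = int (card \<L>)" and "t = int (card T)"
    and "q' = int ?q"
  have "card T \<le> card A" using T_A by (simp add: card_mono)
  then have "a - t \<le> n * (q' - t)"
    using 1 tq unfolding a_def n_def t_def q'_def
    by (metis of_nat_diff of_nat_le_iff of_nat_mult)
  moreover have "int (card \<L> * (?q - 2)) \<le> int (card A - 2)" using 2 by (simp only: of_nat_le_iff)
  then have "n * (q' - 2) \<le> a - 2"
    using q q_less_card_A unfolding a_def n_def q'_def by (simp add: of_nat_diff)
  moreover have "q' \<ge> t" "q' \<ge> 16" "t \<ge> 3" "a > q'"
    using tq q \<open>card T \<ge> 3\<close> q_less_card_A by (simp_all add: t_def q'_def a_def)
  \<comment> \<open>Multiplying the bounds by \<open>q' - 2\<close> and \<open>q' - t\<close>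
    produces the same term in \<open>n\<close> on both sides, which drops out.\<close>
  ultimately have "(a - t) * (q' - 2) \<le> (n * (q' - t)) * (q' - 2)"
    "(n * (q' - 2)) * (q' - t) \<le> (a - 2) * (q' - t)"
    by (auto intro!: mult_right_mono)
  then have "(a - t) * (q' - 2) \<le> (a - 2) * (q' - t)" by (simp add: algebra_simps)
  then have "(t - 2) * (a - q') \<le> 0" by (simp add: algebra_simps)
  moreover have "(t - 2) * (a - q') > 0"
    using \<open>t \<ge> 3\<close> \<open>a > q'\<close> by simp
  ultimately show False by simp
qed

section \<open>Sections of the point set and their directions\<close>

lemma collinear_eq:
  assumes A: "P \<in> A" "R \<in> A" "S \<in> A" "R \<noteq> P" "S \<noteq> P" and "S - P \<in> vec.span {R - P}"
  shows "R = S"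
proof (rule ccontr)
  assume "R \<noteq> S"
  then have "card {P, R, S} = 3" using A by auto
  moreover have "{P, R, S} \<subseteq> sect P (vec.span {R - P})"
    using assms by (auto simp: sect_def vec.span_base vec.span_zero)
  then have "card {P, R, S} \<le> card (sect P (vec.span {R - P}))" by (intro card_mono) auto
  ultimately show False using card_sect_line[of P "R - P"] A by simp
qed

text \<open>Two points in the same direction from \<open>P\<close> would be collinear with
  \<open>P\<close>, so the map is injective; since \<open>card A - 1 = card D\<close>, it is also
  onto. The exact size of \<open>D\<close> enters here.\<close>

lemma bij_directions:
  assumes P: "P \<in> A"
  shows "bij_betw (\<lambda>R. vec.span {R - P}) (A - {P}) D"
proof -
  have inj: "inj_on (\<lambda>R. vec.span {R - P}) (A - {P})"
  proof (rule inj_onI)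
    fix R S assume RS: "R \<in> A - {P}" "S \<in> A - {P}" "vec.span {R - P} = vec.span {S - P}"
    then have "S - P \<in> vec.span {R - P}" using vec.span_base[of "S - P"] by simp
    then show "R = S" using RS P collinear_eq[of P R S] by simp
  qed
  have "(\<lambda>R. vec.span {R - P}) ` (A - {P}) = D"
  proof (rule card_subset_eq)
    show "(\<lambda>R. vec.span {R - P}) ` (A - {P}) \<subseteq> D" using P by (auto intro: D_I)
    show "card ((\<lambda>R. vec.span {R - P}) ` (A - {P})) = card D"
      using inj P card_A card_D by (simp add: card_image card_Diff_singleton)
  qed simp
  then show ?thesis using inj by (simp add: bij_betw_def)
qed

text \<open>The bijection above restricts to the points of the section other than \<open>P\<close>
  and the directions in \<open>L\<close>; the summand 1 is \<open>P\<close> itself. For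
  two-dimensional \<open>L\<close> this leaves the sizes 1, 2, 4 and q.\<close>

lemma card_sect:
  assumes P: "P \<in> A" and L: "vec.subspace L"
  shows "card (sect P L) = 1 + card (dirs L)"
proof -
  have "bij_betw (\<lambda>R. vec.span {R - P}) (sect P L - {P}) (dirs L)"
  proof (rule bij_betw_subset[OF bij_directions[OF P]])
    show "(\<lambda>R. vec.span {R - P}) ` (sect P L - {P}) = dirs L"
    proof (intro equalityI subsetI)
      fix d assume "d \<in> (\<lambda>R. vec.span {R - P}) ` (sect P L - {P})"
      then show "d \<in> dirs L" using P L by (auto simp: sect_def intro: dirs_I)
    next
      fix d assume d: "d \<in> dirs L"
      then have "d \<in> (\<lambda>R. vec.span {R - P}) ` (A - {P})"
        using bij_directions[OF P] by (simp add: bij_betw_def dirs_def)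
      then obtain R where "R \<in> A - {P}" "d = vec.span {R - P}" by blast
      then show "d \<in> (\<lambda>R. vec.span {R - P}) ` (sect P L - {P})"
        using d L by (auto simp: dirs_def sect_def span_single_subset_iff)
    qed
  qed (auto simp: sect_def)
  then have "card (sect P L - {P}) = card (dirs L)" by (rule bij_betw_same_card)
  moreover have "P \<in> sect P L" using P L by (simp add: sect_def vec.subspace_0)
  then have "card (sect P L) = Suc (card (sect P L - {P}))"
    by (intro card_Suc_Diff1[symmetric]) auto
  ultimately show ?thesis by simp
qed

text \<open>Supplies the two values, 1 and 0, for the number of directions on the axis of a
  pencil.\<close>

lemma dirs_span:
  assumes "v \<noteq> 0"
  shows "dirs (vec.span {v}) = (if vec.span {v} \<in> D then {vec.span {v}} else {})"
proof -
  have "d = vec.span {v}" if "d \<in> D" "d \<subseteq> vec.span {v}" for d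
  proof -
    obtain w where "w \<noteq> 0" "d = vec.span {w}" using \<open>d \<in> D\<close> by (rule D_E)
    then show ?thesis using that span_single_eq[of w v] vec.span_base[of w "{w}"] by auto
  qed
  then show ?thesis by (auto simp: dirs_def)
qed

section \<open>Secants with q - 1 directions\<close>

text \<open>
  The section \<open>X\<close> of \<open>A\<close> by the solid through two such planes consists of \<open>s q\<close> points on \<open>s\<close>
  parallels to either plane. Parallels to the two planes meet in lines, hence in at most two
  points of \<open>A\<close>, so \<open>s \<ge> q / 2\<close>, and \<open>q\<close> parallels can only cover \<open>X\<close> if every plane of the
  solid has \<open>q - 1\<close> directions. Then \<open>|X|\<close> is \<open>q\<^sup>2 - q\<close> when counted along the pencil through a
  direction, but \<open>q\<^sup>2\<close> along the pencil through a non-direction.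
\<close>

lemma long_secant_unique:
  assumes v: "vec.span {v} \<in> D" "v \<noteq> 0"
    and L1: "vec.subspace L1" "vec.dim L1 = 2" "v \<in> L1" "card (dirs L1) = CARD('a) - 1"
    and L2: "vec.subspace L2" "vec.dim L2 = 2" "v \<in> L2" "card (dirs L2) = CARD('a) - 1"
  shows "L1 = L2"
proof (rule ccontr)
  let ?q = "CARD('a)"
  assume ne: "L1 \<noteq> L2"
  have "\<not> L2 \<subseteq> L1" using ne L1 L2 subspace_eqI[of L2 L1] by auto
  then obtain w where w: "w \<in> L2" "w \<notin> L1" by auto
  define W where "W = vec.span (insert w L1)"
  have W: "vec.subspace W" "L1 \<subseteq> W" "w \<in> W" by (auto simp: W_def vec.span_base)
  have span_L1: "vec.span L1 = L1" using L1 by simp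
  have card_W: "card W = ?q ^ 3"
    using card_span_insert[of w L1] w(2) L1 card_subspace[of L1]
    by (simp add: W_def span_L1 power2_eq_square power3_eq_cube)
  then have dim_W: "vec.dim W = 3" using W by (intro dim_eqI)
  have "w \<notin> vec.span {v}" using w L1 span_single_subset_iff[of L1 v] by auto
  then have "L2 = vec.span {v, w}" using L2 v w span_pair_eq[of L2 v w] by simp
  moreover have "vec.span {v, w} \<subseteq> W" using W L1 by (intro vec.span_minimal) auto
  ultimately have L2_W: "L2 \<subseteq> W" by simp
  have int: "L1 \<inter> L2 \<subseteq> vec.span {v}"
  proof
    fix x assume "x \<in> L1 \<inter> L2"
    then show "x \<in> vec.span {v}"
      using ne v L1 L2 span_pair_eq[of L1 v x] span_pair_eq[of L2 v x] by auto
  qed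
  have "A \<noteq> {}" using q_less_card_A by auto
  then obtain P where P: "P \<in> A" by auto
  define X where "X = sect P W"
  have sub: "sect R L \<subseteq> X" if "R \<in> X" "L \<subseteq> W" for R L
  proof
    fix S assume "S \<in> sect R L"
    then have "(S - R) + (R - P) \<in> W"
      using that W by (intro vec.subspace_add) (auto simp: sect_def X_def)
    then show "S \<in> X" using \<open>S \<in> sect R L\<close> by (simp add: X_def sect_def)
  qed
  have X_A: "X \<subseteq> A" by (auto simp: X_def sect_def)
  \<comment> \<open>\<open>C L\<close> consists of the point sets that the parallels to
    \<open>L\<close> cut out of \<open>X\<close>. Each has 1 + (q - 1) = q points, so
    \<open>card (C L1)\<close> is the number s of parallels.\<close>
  define C where "C = (\<lambda>L. (\<lambda>R. sect R L) ` X)"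
  have C: "?q * card (C L) = card X" "\<Union> (C L) = X"
    if L: "vec.subspace L" "L \<subseteq> W" "card (dirs L) = ?q - 1" for L
  proof -
    have self: "R \<in> sect R L" if "R \<in> X" for R
      using that X_A L by (auto simp: sect_def vec.subspace_0)
    then show un: "\<Union> (C L) = X" using sub[OF _ L(2)] by (auto simp: C_def)
    have "?q * card (C L) = card (\<Union> (C L))"
    proof (rule card_partition)
      fix c assume "c \<in> C L"
      then show "card c = ?q" using card_sect[OF _ L(1)] X_A L(3) q by (auto simp: C_def)
    next
      fix c c' assume c: "c \<in> C L" "c' \<in> C L" "c \<noteq> c'"
      then obtain R R' where R: "c = sect R L" "c' = sect R' L" by (auto simp: C_def)
      show "c \<inter> c' = {}"
      proof (rule ccontr)
        assume "c \<inter> c' \<noteq> {}"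
        then obtain S where "S - R \<in> L" "S - R' \<in> L" by (auto simp: R sect_def)
        then have "(S - R) - (S - R') \<in> L" by (rule vec.subspace_diff[OF L(1)])
        then have RR: "R' - R \<in> L" by simp
        have "Z - R \<in> L \<longleftrightarrow> Z - R' \<in> L" for Z
          using vec.subspace_add[OF L(1) _ RR, of "Z - R'"] vec.subspace_diff[OF L(1) _ RR, of "Z - R"]
          by auto
        then show False using c R by (auto simp: sect_def)
      qed
    qed auto
    then show "?q * card (C L) = card X" using un by simp
  qed
  note C1 = C[OF L1(1) W(2) L1(4)] and C2 = C[OF L2(1) L2_W L2(4)]
  have "?q * card (C L1) = ?q * card (C L2)" using C1 C2 by simp
  then have CC: "card (C L2) = card (C L1)" using q by simp
  have "X \<subseteq> (\<Union>(c, c')\<in>C L1 \<times> C L2. c \<inter> c')" using C1(2) C2(2) by blast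
  then have "card X \<le> card (\<Union>(c, c')\<in>C L1 \<times> C L2. c \<inter> c')" by (intro card_mono) auto
  also have "\<dots> \<le> (\<Sum>(c, c')\<in>C L1 \<times> C L2. card (c \<inter> c'))"
    by (rule order_trans[OF card_UN_le]) (auto simp: case_prod_unfold)
  also have "\<dots> \<le> (\<Sum>x\<in>C L1 \<times> C L2. 2)"
  proof (rule sum_mono, clarify)
    fix c c' assume "c \<in> C L1" "c' \<in> C L2"
    then obtain R R' where R: "c = sect R L1" "c' = sect R' L2" by (auto simp: C_def)
    show "card (c \<inter> c') \<le> 2"
    proof (cases "c \<inter> c' = {}")
      case False
      then obtain S where S: "S \<in> A" "S - R \<in> L1" "S - R' \<in> L2" by (auto simp: R sect_def)
      have "c \<inter> c' \<subseteq> sect S (vec.span {v})"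
      proof
        fix Z assume Z: "Z \<in> c \<inter> c'"
        then have "(Z - R) - (S - R) \<in> L1" "(Z - R') - (S - R') \<in> L2"
          using vec.subspace_diff[OF L1(1) _ S(2), of "Z - R"]
            vec.subspace_diff[OF L2(1) _ S(3), of "Z - R'"] by (auto simp: R sect_def)
        then show "Z \<in> sect S (vec.span {v})" using int Z by (auto simp: R sect_def)
      qed
      then have "card (c \<inter> c') \<le> card (sect S (vec.span {v}))" by (intro card_mono) auto
      then show ?thesis using card_sect_line[OF S(1) v(2)] by simp
    qed simp
  qed
  also have "\<dots> = 2 * (card (C L1) * card (C L1))" by (simp add: CC)
  finally have "?q * card (C L1) \<le> (2 * card (C L1)) * card (C L1)" using C1 by simp
  moreover have "X \<noteq> {}" using P W by (auto simp: X_def sect_def vec.subspace_0)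
  then have "card (C L1) > 0" by (simp add: C_def card_gt_0_iff)
  \<comment> \<open>From q s \<le> 2 s^2 and q \<ge> 16. The bound exceeds 1 + 3, which will exclude
    planes with 0, 1 or 3 directions.\<close>
  ultimately have s: "card (C L1) \<ge> 8" using q by simp
  \<comment> \<open>\<open>X\<close> translated into the vector space \<open>W\<close>, where the
    counts over cosets and pencils apply.\<close>
  define Y where "Y = (\<lambda>R. R - P) ` X"
  have Y_W: "Y \<subseteq> W" by (auto simp: Y_def X_def sect_def)
  have card_Y: "card Y = card X" by (simp add: Y_def card_image inj_on_def)
  have all: "card (dirs L) = ?q - 1"
    if L: "vec.subspace L" "vec.dim L = 2" "L \<subseteq> W" for L
  proof -
    \<comment> \<open>Each of the q cosets of \<open>L\<close> in \<open>W\<close> holds at most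
      \<open>1 + card (dirs L)\<close> points of \<open>Y\<close>, which has s q points in all;
      hence s \<le> \<open>1 + card (dirs L)\<close>.\<close>
    have "card Y * card L \<le> (1 + card (dirs L)) * card W"
    proof (rule card_le_cosets[OF W(1) L(1) L(3) Y_W])
      fix x assume "x \<in> W"
      show "card {y \<in> Y. y - x \<in> L} \<le> 1 + card (dirs L)"
      proof (cases "{y \<in> Y. y - x \<in> L} = {}")
        case False
        then obtain R where R: "R \<in> A" "(R - P) - x \<in> L" using X_A by (auto simp: Y_def)
        have "{y \<in> Y. y - x \<in> L} \<subseteq> (\<lambda>S. S - P) ` sect R L"
        proof
          fix y assume "y \<in> {y \<in> Y. y - x \<in> L}"
          then obtain S where S: "S \<in> A" "y = S - P" "(S - P) - x \<in> L"
            using X_A by (auto simp: Y_def)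
          then have "((S - P) - x) - ((R - P) - x) \<in> L"
            using R by (intro vec.subspace_diff[OF L(1), of "(S - P) - x" "(R - P) - x"])
          then show "y \<in> (\<lambda>S. S - P) ` sect R L" using S by (auto simp: sect_def)
        qed
        then have "card {y \<in> Y. y - x \<in> L} \<le> card ((\<lambda>S. S - P) ` sect R L)"
          by (intro card_mono) auto
        also have "\<dots> \<le> card (sect R L)" by (intro card_image_le) auto
        finally show ?thesis using card_sect[OF R(1) L(1)] by simp
      next
        case True
        show ?thesis unfolding True by simp
      qed
    qed
    then have "card (C L1) * ?q ^ 3 \<le> (1 + card (dirs L)) * ?q ^ 3"
      using C1(1) card_Y card_W card_subspace[OF L(1)] L(2)
      by (simp add: power2_eq_square power3_eq_cube mult_ac)
    then have "card (C L1) \<le> 1 + card (dirs L)" using q by (subst (asm) mult_le_cancel2) simp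
    then show ?thesis using s card_dirs[OF L(1,2)] by auto
  qed
  \<comment> \<open>The axis has \<open>j\<close> directions and so carries \<open>1 + j\<close>
    points of \<open>Y\<close>; each of the q + 1 planes through it has q points, which adds the
    other \<open>?q - (1 + j)\<close>.\<close>
  have pencil: "card X - (1 + j) = (?q + 1) * (?q - (1 + j))"
    if u: "u \<in> W" "u \<noteq> 0" and j: "card (dirs (vec.span {u})) = j" for u j
  proof -
    have Yu: "Y \<inter> L = (\<lambda>R. R - P) ` sect P L" if "L \<subseteq> W" for L
      using that by (auto simp: Y_def X_def sect_def)
    have cY: "card (Y \<inter> L) = 1 + card (dirs L)" if "L \<subseteq> W" "vec.subspace L" for L
      using that card_sect[OF P] by (simp add: Yu card_image inj_on_def)
    have uW: "vec.span {u} \<subseteq> W" using u W by (simp add: span_single_subset_iff)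
    have Diff: "card (Y \<inter> L - vec.span {u}) = card (Y \<inter> L) - (1 + j)"
      if "vec.span {u} \<subseteq> L" for L
    proof -
      have "Y \<inter> L - vec.span {u} = Y \<inter> L - Y \<inter> vec.span {u}" by auto
      moreover have "card (Y \<inter> vec.span {u}) = 1 + j" using cY[OF uW] j by simp
      moreover have "card (Y \<inter> L - Y \<inter> vec.span {u}) = card (Y \<inter> L) - card (Y \<inter> vec.span {u})"
        using that by (intro card_Diff_subset) auto
      ultimately show ?thesis by simp
    qed
    have "card (Y - vec.span {u}) = (?q + 1) * (?q - (1 + j))"
    proof (rule card_pencil[OF W(1) dim_W u Y_W])
      fix L :: "('a ^ 'm) set" assume L: "vec.subspace L" "vec.dim L = 2" "u \<in> L" "L \<subseteq> W"
      then show "card (Y \<inter> L - vec.span {u}) = ?q - (1 + j)"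
        using Diff[of L] cY[of L] all[of L] q by (simp add: span_single_subset_iff)
    qed
    moreover have "Y \<inter> W = Y" using Y_W by auto
    ultimately show ?thesis using Diff[OF uW] card_Y by simp
  qed
  obtain z where z: "z \<in> L1" "z \<noteq> 0" "vec.span {z} \<notin> D"
    using non_direction_exists[OF L1(1,2,4)] .
  \<comment> \<open>The left sides of this equation and the next differ by at most 1, the right
    sides by q + 1.\<close>
  have "card X - 1 = (?q + 1) * (?q - 1)"
    using pencil[of z 0] z W by (auto simp: dirs_span)
  moreover have "card X - 2 = (?q + 1) * (?q - 2)"
    using pencil[of v 1] v L1(3) W(2) by (simp add: dirs_span subset_iff numeral_2_eq_2)
  moreover have "?q + 1 \<ge> 17" using q by simp
  moreover have "(?q + 1) * (?q - 1) = (?q + 1) * (?q - 2) + (?q + 1)"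
  proof -
    have "?q - 1 = (?q - 2) + 1" using q by simp
    then show ?thesis by (simp only: distrib_left mult_1_right)
  qed
  ultimately show False by linarith
qed

section \<open>Completing parallelograms\<close>

text \<open>The three directions of the plane are those from \<open>P\<close> to the other points
  \<open>P + a\<close>, \<open>P + b\<close>, \<open>P + c\<close> of the section. As no three
  points are collinear, the line from \<open>P + b\<close> to \<open>P + c\<close> can only have
  direction \<open>a\<close>, and the line from \<open>P + a\<close> to \<open>P + c\<close> only
  direction \<open>b\<close>. This forces \<open>c = a + b\<close>.\<close>

lemma parallelogram_short:
  assumes A: "P \<in> A" "P + a \<in> A" "P + b \<in> A" and a: "a \<noteq> 0" and b: "b \<notin> vec.span {a}"
    and c3: "card (dirs (vec.span {a, b})) = 3"
  shows "P + a + b \<in> A"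
proof -
  let ?L = "vec.span {a, b}"
  have b0: "b \<noteq> 0" using b by (auto simp: vec.span_zero)
  have L: "a \<in> ?L" "b \<in> ?L" by (auto simp: vec.span_base)
  have ab: "vec.span {a} \<noteq> vec.span {b}" using b vec.span_base by blast
  \<comment> \<open>The section has 1 + 3 points, so there is a fourth one besides the three
    given.\<close>
  have "card (sect P ?L) = 4" using card_sect[OF A(1), of ?L] c3 by simp
  moreover have "card {P, P + a, P + b} \<le> 3" by (simp add: card_insert_if)
  ultimately have "\<not> sect P ?L \<subseteq> {P, P + a, P + b}"
    using card_mono[of "{P, P + a, P + b}" "sect P ?L"] by auto
  then obtain R where R: "R \<in> A" "R - P \<in> ?L" "R \<noteq> P" "R \<noteq> P + a" "R \<noteq> P + b"
    by (auto simp: sect_def)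
  define c where "c = R - P"
  have c: "P + c \<in> A" "c \<in> ?L" "c \<noteq> 0" "c \<noteq> a" "c \<noteq> b" using R by (auto simp: c_def)
  have nc: "x \<notin> vec.span {y}" if "x \<noteq> y" "x \<noteq> 0" "y \<noteq> 0" "P + x \<in> A" "P + y \<in> A" for x y
    using collinear_eq[of P "P + y" "P + x"] A(1) that by auto
  have ne: "vec.span {c} \<noteq> vec.span {a}" "vec.span {c} \<noteq> vec.span {b}"
    using nc[of c a] nc[of c b] c a b0 A vec.span_base by blast+
  have dir: "vec.span {x} \<in> dirs ?L" if "P + x \<in> A" "x \<noteq> 0" "x \<in> ?L" for x
    using dirs_I[of P "P + x" ?L] A that by auto
  have "{vec.span {a}, vec.span {b}, vec.span {c}} = dirs ?L"
  proof (rule card_subset_eq)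
    show "{vec.span {a}, vec.span {b}, vec.span {c}} \<subseteq> dirs ?L"
      using dir A c a b0 L by auto
    show "card {vec.span {a}, vec.span {b}, vec.span {c}} = card (dirs ?L)"
      using ab ne c3 by auto
  qed simp
  then have three: "d \<in> dirs ?L \<Longrightarrow> d \<in> {vec.span {a}, vec.span {b}, vec.span {c}}" for d by simp
  have diff: "x - y \<notin> vec.span {x}" "x - y \<notin> vec.span {y}"
    if h: "x \<noteq> y" "x \<noteq> 0" "y \<noteq> 0" "P + x \<in> A" "P + y \<in> A" for x y
  proof -
    show "x - y \<notin> vec.span {x}"
    proof
      assume "x - y \<in> vec.span {x}"
      from vec.span_diff[OF vec.span_base[of x "{x}"] this]
      have "x - (x - y) \<in> vec.span {x}" by simp
      then show False using nc[of y x] h by simp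
    qed
    show "x - y \<notin> vec.span {y}"
    proof
      assume "x - y \<in> vec.span {y}"
      then have "(x - y) + y \<in> vec.span {y}" by (intro vec.span_add) (auto simp: vec.span_base)
      then show False using nc[of x y] h by simp
    qed
  qed
  have sub: "x - y \<in> ?L" if "x \<in> ?L" "y \<in> ?L" for x y using that by (rule vec.span_diff)
  have "vec.span {c - b} \<in> dirs ?L"
    using dirs_I[of "P + b" "P + c" ?L] A c sub L by auto
  then have "c - b \<in> vec.span {a}"
    using three[of "vec.span {c - b}"] diff[of c b] c b0 A vec.span_base[of "c - b" "{c - b}"] by auto
  then obtain l where l: "c - b = l *s a" by (auto simp: vec.span_singleton)
  have "vec.span {c - a} \<in> dirs ?L"
    using dirs_I[of "P + a" "P + c" ?L] A c sub L by auto
  then have "c - a \<in> vec.span {b}"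
    using three[of "vec.span {c - a}"] diff[of c a] c a A vec.span_base[of "c - a" "{c - a}"] by auto
  then obtain m where m: "c - a = m *s b" by (auto simp: vec.span_singleton)
  \<comment> \<open>Compares \<open>c = b + l *s a\<close> with \<open>c = a + m *s b\<close>;
    independence of \<open>a\<close> and \<open>b\<close> then gives \<open>m = 1\<close>.\<close>
  have eq: "(1 - m) *s b = (1 - l) *s a"
    using l m by (simp add: vec.scale_left_diff_distrib algebra_simps)
  then have "(1 - m) *s b \<in> vec.span {a}" by (auto simp: vec.span_singleton)
  then have "m = 1" using b mem_span_scale_imp[of "1 - m"] by simp
  then have "c = a + b" using m by (simp add: algebra_simps)
  then show ?thesis using c by (simp add: add.assoc)
qed

text \<open>If the plane has q - 1 directions, the fourth point is reached in two steps, through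
  planes that contain the direction \<open>a\<close> but are not parallel to the given one. By
  uniqueness of the long secant through \<open>a\<close> these have three directions, where the
  short case applies.\<close>

lemma parallelogram:
  assumes A: "P \<in> A" "P + a \<in> A" "P + b \<in> A" and a: "a \<noteq> 0" and b: "b \<notin> vec.span {a}"
  shows "P + a + b \<in> A"
proof -
  have a_D: "vec.span {a} \<in> D" using A a D_I[of P "P + a"] by simp
  \<comment> \<open>The two different directions of \<open>a\<close> and \<open>x\<close> exclude
    the values 0 and 1.\<close>
  have type: "card (dirs (vec.span {a, x})) \<in> {3, CARD('a) - 1}"
    if x: "R \<in> A" "R + x \<in> A" "x \<notin> vec.span {a}" for R x
  proof -
    have x0: "x \<noteq> 0" using x by (auto simp: vec.span_zero)
    have "vec.span {x} \<in> D" using x x0 D_I[of R "R + x"] by simp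
    then have "{vec.span {a}, vec.span {x}} \<subseteq> dirs (vec.span {a, x})"
      using a_D by (auto simp: dirs_def span_single_subset_iff vec.span_base simp del: vec.span_singleton)
    then have "card {vec.span {a}, vec.span {x}} \<le> card (dirs (vec.span {a, x}))"
      by (intro card_mono) auto
    moreover have "vec.span {a} \<noteq> vec.span {x}" using x vec.span_base by blast
    ultimately show ?thesis
      using card_dirs[of "vec.span {a, x}"] dim_span_pair[OF a x(3)] by auto
  qed
  let ?L = "vec.span {a, b}"
  show ?thesis
  proof (cases "card (dirs ?L) = 3")
    case True
    then show ?thesis using parallelogram_short assms by blast
  next
    case False
    then have big: "card (dirs ?L) = CARD('a) - 1" using type[OF A(1,3) b] by simp
    have dimL: "vec.dim ?L = 2" using a b by (rule dim_span_pair)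
    have short: "R + a + x \<in> A" if x: "R \<in> A" "R + a \<in> A" "R + x \<in> A" "x \<notin> ?L" for R x
    proof -
      have xa: "x \<notin> vec.span {a}"
        using x vec.span_mono[of "{a}" "{a, b}"] by auto
      have "card (dirs (vec.span {a, x})) \<noteq> CARD('a) - 1"
      proof
        assume "card (dirs (vec.span {a, x})) = CARD('a) - 1"
        then have "?L = vec.span {a, x}"
          using long_secant_unique[of a ?L "vec.span {a, x}"] a_D a big dimL dim_span_pair[OF a xa]
          by (simp add: vec.span_base)
        then show False using x vec.span_base[of x "{a, x}"] by simp
      qed
      then have "card (dirs (vec.span {a, x})) = 3" using type[OF x(1,3) xa] by simp
      then show ?thesis using parallelogram_short[of R a x] x a xa by simp
    qed
    \<comment> \<open>A plane section has at most q points here, fewer than the q^k points of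
      \<open>A\<close>, so some point of \<open>A\<close> lies off the plane.\<close>
    have "card (sect P ?L) < card A"
      using q_less_card_A card_sect_le[of ?L P] dimL big by simp
    then have "\<not> A \<subseteq> sect P ?L" using card_mono[of "sect P ?L" A] by auto
    then obtain R where R: "R \<in> A" "R - P \<notin> ?L" by (auto simp: sect_def)
    define c where "c = R - P"
    have c: "P + c \<in> A" "c \<notin> ?L" using R by (auto simp: c_def)
    have "P + c + a \<in> A" using short[of P c] A c by (simp add: add_ac)
    moreover have "b - c \<notin> ?L"
      using c vec.span_diff[of b "{a, b}" "b - c"] by (auto simp: vec.span_base)
    \<comment> \<open>From the base point \<open>P + c\<close> the vector \<open>b - c\<close> leads
      to the given point \<open>P + b\<close>, and the detour over \<open>c\<close> cancels.\<close>
    ultimately have "P + c + a + (b - c) \<in> A" using short[of "P + c" "b - c"] A c by simp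
    then show ?thesis by (simp add: algebra_simps)
  qed
qed

section \<open>The additive group\<close>

text \<open>Moving \<open>P\<close> to the origin turns \<open>A\<close> into a set \<open>U\<close>
  closed under addition: parallelograms handle independent summands, characteristic 2 handles equal
  ones. All directions are seen from \<open>P\<close>, so they are the spans of the nonzero vectors
  of \<open>U\<close>.\<close>

lemma linear_directions:
  assumes char2: "(1 :: 'a) + 1 = 0"
  shows "\<exists>U. subspace_over {0, 1} U \<and> D = {vec.span {u} | u. u \<in> U - {0}}"
proof -
  have "A \<noteq> {}" using q_less_card_A by auto
  then obtain P where P: "P \<in> A" by auto
  define U where "U = {u. P + u \<in> A}"
  have double: "x + x = 0" for x :: "'a ^ 'm"
    using char2 by (metis vec.scale_left_distrib vec.scale_one vec.scale_zero_left)
  have "a + b \<in> U" if "a \<in> U" "b \<in> U" for a b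
  proof (cases "a = 0 \<or> b = 0 \<or> a = b")
    case True
    then show ?thesis using that P double by (auto simp: U_def)
  next
    case False
    \<comment> \<open>Otherwise \<open>P\<close>, \<open>P + a\<close> and \<open>P + b\<close>
      would be three collinear points of \<open>A\<close>.\<close>
    then have "b \<notin> vec.span {a}"
      using collinear_eq[of P "P + a" "P + b"] P that by (auto simp: U_def)
    then show ?thesis
      using parallelogram[of P a b] False that P by (simp add: U_def add_ac)
  qed
  then have "subspace_over {0, 1} U" using P by (auto simp: subspace_over_def U_def)
  moreover have "D = {vec.span {u} | u. u \<in> U - {0}}"
  proof (intro equalityI subsetI)
    fix d assume "d \<in> D"
    then obtain R where "R \<in> A - {P}" "d = vec.span {R - P}"
      using bij_directions[OF P] by (auto simp: bij_betw_def)
    then show "d \<in> {vec.span {u} | u. u \<in> U - {0}}" 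
      by (auto simp: U_def intro!: exI[of _ "R - P"])
  next
    fix d assume "d \<in> {vec.span {u} | u. u \<in> U - {0}}"
    then show "d \<in> D" using D_I[OF P] by (fastforce simp: U_def)
  qed
  ultimately show ?thesis by blast
qed

end

section \<open>From projective to affine coordinates\<close>

text \<open>The map \<open>\<iota>\<close> identifies the coordinate space with the hyperplane at
  infinity. After fixing \<open>v0\<close> outside \<open>H\<close>, each affine point contains
  exactly one vector \<open>v0 + \<iota> w\<close>; the vectors \<open>w\<close> obtained from
  \<open>Q\<close> form the set \<open>A\<close> of the affine setting, and differences of such
  vectors yield the directions.\<close>

theorem theorem3p7:
  fixes H :: "('a::{field,finite} ^ 'n::finite) set"
    and Q D :: "('a ^ 'n) set set"
    and \<iota> :: "'a ^ 'm::finite \<Rightarrow> 'a ^ 'n"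
    and h k q :: nat
  assumes "h \<ge> 4" and "k \<ge> 2" and "q = 2 ^ h"
    and "CARD('a) = q" and "CARD('n) = 2 * k + 1" and "CARD('m) = 2 * k"
    and "H \<in> pg_hyperplanes"
    and "Vector_Spaces.linear (*s) (*s) \<iota>" and "bij_betw \<iota> UNIV H"
    and "Q \<subseteq> affine_points H" and "card Q = q ^ k"
    and "D = directions H Q" and "card D = q ^ k - 1"
    and "\<And>l. l \<in> pg_lines \<Longrightarrow> card {P \<in> D. P \<subseteq> l} \<in> {0, 1, 3, q - 1}"
  shows "\<exists>U :: ('a ^ 'm) set. subspace_over {0, 1} U \<and>
           D = {\<iota> ` vec.span {u} | u. u \<in> U - {0}}"
proof -
  interpret lin: Vector_Spaces.linear "(*s)" "(*s)" \<iota> by fact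
  have H: "vec.subspace H" "vec.dim H + 1 = CARD('n)"
    using assms(7) by (auto simp: pg_hyperplanes_def)
  have inj: "inj \<iota>" and range: "range \<iota> = H" using assms(9) by (auto simp: bij_betw_def)
  have inH: "\<iota> w \<in> H" for w using range by auto
  have q16: "q \<ge> 16" using power_increasing[of 4 h "2::nat"] assms(1,3) by simp
  have "H \<noteq> UNIV" using H card_subspace[of H] card_field_gt_1[where 'a='a]
    by (metis CARD_vec Suc_eq_plus1 n_not_Suc_n power_inject_exp)
  then obtain v0 where v0: "v0 \<notin> H" by auto
  have spanH: "vec.span H = H" using H by simp
  have UN: "vec.span (insert v0 H) = UNIV"
  proof (rule subspace_eqI)
    have "card (vec.span (insert v0 H)) = CARD('a) ^ CARD('n)"
      using card_span_insert[of v0 H] v0 card_subspace[OF H(1)] H(2) by (simp add: spanH flip: H(2))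
    then have "vec.dim (vec.span (insert v0 H)) = CARD('n)" by (simp only: dim_eqI vec.subspace_span)
    moreover have "vec.dim (UNIV :: ('a ^ 'n) set) = CARD('n)" by (rule dim_eqI) simp_all
    ultimately show "vec.dim (vec.span (insert v0 H)) = vec.dim (UNIV :: ('a ^ 'n) set)" by simp
  qed auto
  have v0H: "c = 0" if "c *s v0 + y \<in> H" "y \<in> H" for c y
  proof -
    have "(c *s v0 + y) - y \<in> H" using that H by (intro vec.subspace_diff)
    then have "c *s v0 \<in> vec.span H" by (simp add: spanH)
    then show ?thesis using v0 mem_span_scale_imp[of c v0 H] by (simp add: spanH)
  qed
  define p where "p = (\<lambda>w. vec.span {v0 + \<iota> w})"
  define A where "A = {w. p w \<in> Q}"
  have inj_p: "inj p"
  proof (rule injI)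
    fix x y assume "p x = p y"
    then have "v0 + \<iota> x \<in> vec.span {v0 + \<iota> y}" using vec.span_base by (auto simp: p_def)
    then obtain c where c: "v0 + \<iota> x = c *s (v0 + \<iota> y)" by (auto simp: vec.span_singleton)
    then have eq: "(1 - c) *s v0 + \<iota> x = c *s \<iota> y"
      by (simp add: vec.scale_left_diff_distrib vec.scale_right_distrib algebra_simps)
    have "(1 - c) *s v0 + \<iota> x \<in> H" unfolding eq using H inH by (intro vec.subspace_scale)
    then have "1 - c = 0" using inH by (rule v0H)
    then show "x = y" using eq inj by (auto dest: injD)
  qed
  have pA: "p ` A = Q"
  proof (intro equalityI subsetI)
    fix P assume P: "P \<in> Q"
    then have P': "vec.subspace P" "vec.dim P = 1" "\<not> P \<subseteq> H"
      using assms(10) by (auto simp: affine_points_def pg_points_def)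
    then obtain x where x: "x \<in> P" "x \<notin> H" by auto
    have "x \<in> vec.span (insert v0 H)" using UN by simp
    then obtain c where c: "x - c *s v0 \<in> H" by (auto simp: vec.span_breakdown_eq spanH)
    have c0: "c \<noteq> 0" using c x by auto
    \<comment> \<open>The scalar \<open>c\<close> is the coefficient of \<open>x\<close> at
      \<open>v0\<close>; dividing by it normalises the representative to coefficient 1.\<close>
    have "(1 / c) *s (x - c *s v0) \<in> H" using H c by (intro vec.subspace_scale)
    then obtain w where w: "\<iota> w = (1 / c) *s (x - c *s v0)" using range by (metis imageE)
    have "v0 + \<iota> w = (1 / c) *s x"
      using c0 by (simp add: w vec.scale_right_diff_distrib)
    then have inP: "v0 + \<iota> w \<in> P" using P' x by (simp add: vec.subspace_scale)
    have "v0 + \<iota> w \<noteq> 0" 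
      using v0H[of 1 "\<iota> w"] inH vec.subspace_0[OF H(1)] by auto
    then have "vec.dim (p w) = 1" unfolding p_def by (rule dim_span_single)
    moreover have "vec.subspace (p w)" "p w \<subseteq> P"
      using inP P'(1) by (simp_all add: p_def span_single_subset_iff)
    ultimately have "p w = P" using P' by (intro subspace_eqI) simp_all
    then show "P \<in> p ` A" using P by (auto simp: A_def)
  qed (auto simp: A_def)
  have card_A: "card A = q ^ k"
    using pA assms(11) card_image[OF inj_on_subset[OF inj_p subset_UNIV], of A] by simp
  have \<iota>_span: "\<iota> ` vec.span {w} = vec.span {\<iota> w}" for w
    by (simp add: lin.span_image[of "{w}", simplified])
  have join: "Defs.join (p x) (p y) \<inter> H = \<iota> ` vec.span {y - x}" for x y
  proof -
    have "Defs.join (p x) (p y) = vec.span {v0 + \<iota> x, v0 + \<iota> y}"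
    proof
      show "Defs.join (p x) (p y) \<subseteq> vec.span {v0 + \<iota> x, v0 + \<iota> y}"
        unfolding Defs.join_def p_def by (intro vec.span_minimal Un_least vec.span_mono) auto
      show "vec.span {v0 + \<iota> x, v0 + \<iota> y} \<subseteq> Defs.join (p x) (p y)"
        unfolding Defs.join_def p_def by (intro vec.span_mono) (auto simp: vec.span_base)
    qed
    moreover have "vec.span {v0 + \<iota> x, v0 + \<iota> y} \<inter> H = vec.span {\<iota> (y - x)}"
    proof (intro equalityI subsetI)
      fix z assume z: "z \<in> vec.span {v0 + \<iota> x, v0 + \<iota> y} \<inter> H"
      then obtain c where "z - c *s (v0 + \<iota> x) \<in> vec.span {v0 + \<iota> y}"
        by (auto simp: vec.span_breakdown_eq)
      then obtain d where d: "z - c *s (v0 + \<iota> x) = d *s (v0 + \<iota> y)"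
        by (auto simp: vec.span_singleton)
      \<comment> \<open>Both representatives have coefficient 1 at \<open>v0\<close>, so a
        combination lies in \<open>H\<close> just when its two coefficients cancel, which leaves a
        multiple of their difference.\<close>
      have z_eq: "z = (c + d) *s v0 + (c *s \<iota> x + d *s \<iota> y)"
        using d by (simp add: vec.scale_left_distrib vec.scale_right_distrib algebra_simps)
      have "c *s \<iota> x + d *s \<iota> y \<in> H"
        using H inH by (intro vec.subspace_add vec.subspace_scale)
      then have "c + d = 0" using z z_eq v0H by auto
      then have "c = - d" by (simp add: add_eq_0_iff2)
      then have "z = d *s \<iota> (y - x)"
        using z_eq by (simp add: lin.diff vec.scale_right_diff_distrib)
      then show "z \<in> vec.span {\<iota> (y - x)}" by (auto simp: vec.span_singleton)
    next
      fix z assume "z \<in> vec.span {\<iota> (y - x)}"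
      then obtain c where c: "z = c *s \<iota> (y - x)" by (auto simp: vec.span_singleton)
      then have z: "z = c *s ((v0 + \<iota> y) - (v0 + \<iota> x))" by (simp add: lin.diff)
      have "z \<in> vec.span {v0 + \<iota> x, v0 + \<iota> y}"
        unfolding z by (intro vec.span_scale vec.span_diff[of "v0 + \<iota> y"] vec.span_base) auto
      moreover have "z \<in> H" unfolding c using H inH by (intro vec.subspace_scale)
      ultimately show "z \<in> vec.span {v0 + \<iota> x, v0 + \<iota> y} \<inter> H" by simp
    qed
    ultimately show ?thesis by (simp add: \<iota>_span)
  qed
  \<comment> \<open>\<open>D\<close> pulled back along \<open>\<iota>\<close>.\<close>
  define E where "E = {vec.span {R - P} | P R. P \<in> A \<and> R \<in> A \<and> P \<noteq> R}"
  have D_E: "D = (\<lambda>d. \<iota> ` d) ` E"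
  proof -
    have "D = {Defs.join (p x) (p y) \<inter> H | x y. x \<in> A \<and> y \<in> A \<and> p x \<noteq> p y}"
      unfolding assms(12) directions_def pA[symmetric] by blast
    also have "\<dots> = {\<iota> ` vec.span {y - x} | x y. x \<in> A \<and> y \<in> A \<and> x \<noteq> y}"
      by (simp add: join inj_eq[OF inj_p])
    also have "\<dots> = (\<lambda>d. \<iota> ` d) ` E" unfolding E_def by blast
    finally show ?thesis .
  qed
  have inj_image: "inj_on (\<lambda>d. \<iota> ` d) S" for S
    using inj by (auto simp: inj_on_def inj_image_eq_iff)
  have "few_directions A E k"
  proof
    show "card E = CARD('a) ^ k - 1"
      using assms(4,13) D_E card_image[OF inj_image[of E]] by simp
    fix L :: "('a ^ 'm) set" assume L: "vec.subspace L" "vec.dim L = 2"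
    \<comment> \<open>The image of \<open>L\<close> is a line of \<open>H\<close>, and injectivity
      of \<open>\<iota>\<close> matches the directions on it with the members of \<open>E\<close>
      inside \<open>L\<close>, so the intersection numbers carry over.\<close>
    have sub: "vec.subspace (\<iota> ` L)" using L(1) by (rule lin.subspace_image)
    moreover have "card (\<iota> ` L) = CARD('a) ^ 2"
      using card_subspace[OF L(1)] L(2) inj by (simp add: card_image inj_on_subset[OF inj])
    ultimately have "\<iota> ` L \<in> pg_lines" by (simp add: pg_lines_def dim_eqI)
    moreover have "{P \<in> D. P \<subseteq> \<iota> ` L} = (\<lambda>d. \<iota> ` d) ` {d \<in> E. d \<subseteq> L}"
      using inj by (auto simp: D_E inj_image_subset_iff)
    ultimately show "card {d \<in> E. d \<subseteq> L} \<in> {0, 1, 3, CARD('a) - 1}"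
      using assms(14)[of "\<iota> ` L"] assms(4) card_image[OF inj_image[of "{d \<in> E. d \<subseteq> L}"]] by simp
  qed (use assms(2,4) card_A q16 E_def in auto)
  moreover have "(1 :: 'a) + 1 = 0"
  proof -
    \<comment> \<open>The characteristic is a prime divisor of the field order, a power of
      2.\<close>
    have "CHAR('a) dvd 2 ^ h" using CHAR_dvd_CARD[where 'a='a] assms(3,4) by simp
    moreover have "prime CHAR('a)"
      using prime_CHAR_semidom[where 'a='a] finite_imp_CHAR_pos[where 'a='a] by simp
    ultimately have "CHAR('a) = 2" using prime_dvd_power[of "CHAR('a)" 2 h] 
      by (metis primes_dvd_imp_eq two_is_prime_nat)
    then show ?thesis using of_nat_CHAR[where 'a='a] by simp
  qed
  ultimately obtain U where "subspace_over {0, 1} U" "E = {vec.span {u} | u. u \<in> U - {0}}"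
    using few_directions.linear_directions by blast
  then show ?thesis using D_E by (intro exI[of _ U]) blast
qed

end
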